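(* Let $d\ge 1$ and let $L\subset\mathbb{R}^d$ be a finite set of size $n$ in which all pairs of points have distinct distances. The game of friendly frogs played on $L$ is a win for Alice if $n$ is odd, and a win for Bob if $n$ is even.
   Context: Distances are Euclidean, $|\cdot|$ being the Euclidean norm. "All pairs of points have distinct distances" means: if $\{x,y\}\ne\{u,v\}$ are two unordered pairs of distinct points of $L$ then $|x-y|\neq|u-v|$. Friendly frogs on $L$ is the following two-player game. First Alice chooses a point of $L$ and places a frog on it. Then Bob places a second frog on a different point of $L$. Then the players alternately move, starting with Alice. A move consists of moving either one of the two frogs (both players may move either frog) to another point of $L$, in such a way that the distance between the two frogs is strictly decreased and the two frogs do not occupy the same point. A player who on their turn (including an opening placement) has no legal move loses, and the other player wins. A strategy for a player assigns a legal move (if one exists) to each position; a winning strategy is one that results in a win for that player whatever strategy the other player uses. The game is a win for a player if that player has a winning strategy. *)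

theory Defs
  imports "HOL-Analysis.Analysis"
begin

definition distinct_distances :: "'a::metric_space set \<Rightarrow> bool" where
  "distinct_distances L \<longleftrightarrow>
    (\<forall>x\<in>L. \<forall>y\<in>L. \<forall>u\<in>L. \<forall>v\<in>L.
      x \<noteq> y \<and> u \<noteq> v \<and> {x, y} \<noteq> {u, v} \<longrightarrow> dist x y \<noteq> dist u v)"

datatype player = Alice | Bob

fun opponent :: "player \<Rightarrow> player" where
  "opponent Alice = Bob"
| "opponent Bob = Alice"

text \<open>In a position with two frogs, the player argument is the player whose turn it is;
  the opening placements are made by Alice (first frog) and Bob (second frog).\<close>

datatype 'a position =
    No_Frog
  | One_Frog 'a
  | Two_Frogs player 'a 'a

fun to_move :: "'a position \<Rightarrow> player" where
  "to_move No_Frog = Alice"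
| "to_move (One_Frog x) = Bob"
| "to_move (Two_Frogs p x y) = p"

inductive legal_move :: "'a::metric_space set \<Rightarrow> 'a position \<Rightarrow> 'a position \<Rightarrow> bool"
  for L where
  place_first: "x \<in> L \<Longrightarrow> legal_move L No_Frog (One_Frog x)"
| place_second: "y \<in> L \<Longrightarrow> y \<noteq> x \<Longrightarrow> legal_move L (One_Frog x) (Two_Frogs Alice x y)"
| move_first: "z \<in> L \<Longrightarrow> z \<noteq> x \<Longrightarrow> z \<noteq> y \<Longrightarrow> dist z y < dist x y \<Longrightarrow>
    legal_move L (Two_Frogs p x y) (Two_Frogs (opponent p) z y)"
| move_second: "z \<in> L \<Longrightarrow> z \<noteq> y \<Longrightarrow> z \<noteq> x \<Longrightarrow> dist x z < dist x y \<Longrightarrow>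
    legal_move L (Two_Frogs p x y) (Two_Frogs (opponent p) x z)"

definition terminal :: "'a::metric_space set \<Rightarrow> 'a position \<Rightarrow> bool" where
  "terminal L q \<longleftrightarrow> (\<nexists>q'. legal_move L q q')"

text \<open>A strategy maps a position to the position reached by the chosen move. Its values at
  terminal positions and at positions where the other player is to move are irrelevant.\<close>

definition strategy ::
    "'a::metric_space set \<Rightarrow> player \<Rightarrow> ('a position \<Rightarrow> 'a position) \<Rightarrow> bool" where
  "strategy L P s \<longleftrightarrow>
    (\<forall>q. to_move q = P \<and> \<not> terminal L q \<longrightarrow> legal_move L q (s q))"

text \<open>The sequence of positions when player \<open>P\<close> follows \<open>s\<close> and the opponent follows \<open>t\<close>.
  It is meaningful only up to the first terminal position.\<close>

fun play ::
    "player \<Rightarrow> ('a position \<Rightarrow> 'a position) \<Rightarrow> ('a position \<Rightarrow> 'a position) \<Rightarrow> nat \<Rightarrow> 'a position"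
  where
  "play P s t 0 = No_Frog"
| "play P s t (Suc k) =
    (let q = play P s t k in if to_move q = P then s q else t q)"

definition wins_play ::
    "'a::metric_space set \<Rightarrow> player \<Rightarrow> ('a position \<Rightarrow> 'a position) \<Rightarrow> ('a position \<Rightarrow> 'a position) \<Rightarrow> bool"
  where
  "wins_play L P s t \<longleftrightarrow>
    (\<exists>k. (\<forall>j<k. \<not> terminal L (play P s t j)) \<and>
         terminal L (play P s t k) \<and> to_move (play P s t k) = opponent P)"

definition winning_strategy ::
    "'a::metric_space set \<Rightarrow> player \<Rightarrow> ('a position \<Rightarrow> 'a position) \<Rightarrow> bool" where
  "winning_strategy L P s \<longleftrightarrow>
    strategy L P s \<and> (\<forall>t. strategy L (opponent P) t \<longrightarrow> wins_play L P s t)"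

definition friendly_frogs_win_for :: "'a::metric_space set \<Rightarrow> player \<Rightarrow> bool" where
  "friendly_frogs_win_for L P \<longleftrightarrow> (\<exists>s. winning_strategy L P s)"

end

theory Submission
  imports Defs
begin

text \<open>Repeatedly matching and removing a closest pair yields an involution \<open>m\<close> of \<open>L\<close> that is
  stable: if \<open>x\<close> and \<open>y\<close> are not matched to each other, then one of them is strictly closer to its
  partner than to the other. By stability, a player facing an unmatched pair of frogs can move to
  a matched pair, whereas every move from a matched pair destroys it. Hence the player to move
  at a matched pair loses. If \<open>card L\<close> is odd, Alice opens at the point without a partner; if it
  is even, Bob answers with the partner of Alice's point.\<close>

section \<open>Stable matchings of a finite set with distinct distances\<close>

text \<open>A point without a partner is encoded as a fixed point of \<open>m\<close>.\<close>

definition stable_matching :: "'a::metric_space set \<Rightarrow> ('a \<Rightarrow> 'a) \<Rightarrow> bool" where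
  "stable_matching L m \<longleftrightarrow>
    (\<forall>x\<in>L. m x \<in> L \<and> m (m x) = x) \<and>
    (\<forall>x\<in>L. \<forall>y\<in>L. x \<noteq> y \<and> m x \<noteq> y \<longrightarrow>
      (m x \<noteq> x \<and> dist x (m x) < dist x y) \<or> (m y \<noteq> y \<and> dist y (m y) < dist x y))"

lemma stable_matchingD:
  assumes "stable_matching L m" "x \<in> L"
  shows "m x \<in> L" "m (m x) = x"
  using assms by (auto simp: stable_matching_def)

text \<open>A minimum over the finitely many pairs exists; distinct distances make it strict, which
  is what the strict inequality in stability requires.\<close>

lemma closest_pair_exists:
  fixes L :: "'a::metric_space set"
  assumes "finite L" "card L \<ge> 2" "distinct_distances L"
  obtains a b where "a \<in> L" "b \<in> L" "a \<noteq> b"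
    "\<And>x y. x \<in> L \<Longrightarrow> y \<in> L \<Longrightarrow> x \<noteq> y \<Longrightarrow> {x, y} \<noteq> {a, b} \<Longrightarrow> dist a b < dist x y"
proof -
  define S where "S = {(x, y). x \<in> L \<and> y \<in> L \<and> x \<noteq> y}"
  have "finite S"
    by (rule finite_subset[of _ "L \<times> L"]) (use assms(1) in \<open>auto simp: S_def\<close>)
  moreover have "S \<noteq> {}"
  proof
    assume "S = {}"
    then have "is_singleton L \<or> L = {}"
      by (auto simp: S_def intro!: is_singletonI')
    then show False
      using assms(2) by (auto simp: is_singleton_altdef)
  qed
  ultimately obtain p where p: "p \<in> S" 
      "\<And>q. q \<in> S \<Longrightarrow> (case p of (x, y) \<Rightarrow> dist x y) \<le> (case q of (x, y) \<Rightarrow> dist x y)"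
    using ex_is_arg_min_if_finite[of S "\<lambda>(x, y). dist x y"]
    by (auto simp: is_arg_min_linorder)
  obtain a b where ab: "p = (a, b)" by (cases p)
  show thesis
  proof
    show "a \<in> L" "b \<in> L" "a \<noteq> b" using p(1) ab by (auto simp: S_def)
    fix x y assume xy: "x \<in> L" "y \<in> L" "x \<noteq> y" "{x, y} \<noteq> {a, b}"
    then have "dist a b \<le> dist x y" using p(2)[of "(x, y)"] ab by (auto simp: S_def)
    moreover have "dist a b \<noteq> dist x y"
      using assms(3) xy \<open>a \<in> L\<close> \<open>b \<in> L\<close> \<open>a \<noteq> b\<close> unfolding distinct_distances_def by metis
    ultimately show "dist a b < dist x y" by simp
  qed
qed

text \<open>Induction on the cardinality: match a closest pair and recurse on the rest. Two points
  go at a time, so the parity of \<open>card L\<close> decides whether one is left over.\<close>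

lemma stable_matching_exists:
  fixes L :: "'a::metric_space set"
  assumes "finite L" "distinct_distances L"
  shows "\<exists>m. stable_matching L m \<and> ((\<exists>x\<in>L. m x = x) \<longleftrightarrow> odd (card L))"
  using assms
proof (induction "card L" arbitrary: L rule: less_induct)
  case less
  show ?case
  proof (cases "card L \<ge> 2")
    case False
    then have "card L = 0 \<or> card L = 1" by linarith
    then have "L = {} \<or> (\<exists>x. L = {x})"
      using less.prems(1) by (auto simp: card_1_singleton_iff)
    \<comment> \<open>With at most one point stability is vacuous, and a sole point is fixed by
      \<open>id\<close>, hence unmatched.\<close>
    then show ?thesis
      by (intro exI[of _ id]) (auto simp: stable_matching_def)
  next
    case True
    then obtain a b where ab: "a \<in> L" "b \<in> L" "a \<noteq> b"
      and close: "\<And>x y. x \<in> L \<Longrightarrow> y \<in> L \<Longrightarrow> x \<noteq> y \<Longrightarrow> {x, y} \<noteq> {a, b} \<Longrightarrow> dist a b < dist x y"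
      using closest_pair_exists less.prems by metis
    define L' where "L' = L - {a, b}"
    have card: "card L = card L' + 2"
      using ab True less.prems(1) by (simp add: L'_def card_Diff_subset)
    have "distinct_distances L'"
      using less.prems(2) unfolding distinct_distances_def L'_def by blast
    then obtain m where m: "stable_matching L' m" "(\<exists>x\<in>L'. m x = x) \<longleftrightarrow> odd (card L')"
      using less.hyps[of L'] less.prems(1) card by (auto simp: L'_def)
    define m' where "m' = m(a := b, b := a)"
    have m'_ab: "m' a = b" "m' b = a" using ab by (auto simp: m'_def)
    have m'_eq: "m' x = m x" if "x \<in> L'" for x using that by (auto simp: m'_def L'_def)
    have L: "L = insert a (insert b L')" using ab by (auto simp: L'_def)
    have "stable_matching L m'"
      unfolding stable_matching_def
    proof (intro conjI ballI impI)
      fix x assume "x \<in> L"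
      then show "m' x \<in> L" "m' (m' x) = x"
        using stable_matchingD[OF m(1)] m'_ab m'_eq L by auto
    next
      fix x y assume xy: "x \<in> L" "y \<in> L" "x \<noteq> y \<and> m' x \<noteq> y"
      consider "x \<in> L'" "y \<in> L'" | "x \<in> {a, b}" | "y \<in> {a, b}"
        using xy L by blast
      then show "m' x \<noteq> x \<and> dist x (m' x) < dist x y \<or> m' y \<noteq> y \<and> dist y (m' y) < dist x y"
      proof cases
        case 1
        then show ?thesis using m(1) xy(3) by (simp add: m'_eq stable_matching_def)
      next
        case 2
        \<comment> \<open>The partner of \<open>x\<close> is the other point of the closest pair, so
          \<open>dist x (m' x)\<close> is the minimal distance.\<close>
        then have "{x, y} \<noteq> {a, b}" using xy m'_ab by (auto simp: doubleton_eq_iff)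
        then have "dist a b < dist x y" using close xy by blast
        then show ?thesis using 2 ab(3) m'_ab by (auto simp: dist_commute)
      next
        case 3
        then have "{x, y} \<noteq> {a, b}" using xy m'_ab by (auto simp: doubleton_eq_iff)
        then have "dist a b < dist x y" using close xy by blast
        then show ?thesis using 3 ab(3) m'_ab by (auto simp: dist_commute)
      qed
    qed
    moreover have "(\<exists>x\<in>L. m' x = x) \<longleftrightarrow> odd (card L)"
      using m(2) card m'_ab m'_eq L ab(3) by auto
    ultimately show ?thesis by blast
  qed
qed

section \<open>Termination of the game and winning by an invariant\<close>

lemma opponent_opponent [simp]: "opponent (opponent p) = p"
  by (cases p) auto

lemma opponent_neq [simp]: "opponent p \<noteq> p"
  by (cases p) auto

lemma to_move_legal_move: "legal_move L q q' \<Longrightarrow> to_move q' = opponent (to_move q)"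
  by (auto elim: legal_move.cases)

fun frogs_in :: "'a set \<Rightarrow> 'a position \<Rightarrow> bool" where
  "frogs_in L No_Frog \<longleftrightarrow> True"
| "frogs_in L (One_Frog x) \<longleftrightarrow> x \<in> L"
| "frogs_in L (Two_Frogs p x y) \<longleftrightarrow> x \<in> L \<and> y \<in> L"

lemma frogs_in_legal_move: "legal_move L q q' \<Longrightarrow> frogs_in L q \<Longrightarrow> frogs_in L q'"
  by (auto elim: legal_move.cases)

text \<open>A termination measure: with two frogs, the number of ordered pairs of \<open>L\<close>
  closer together than the frogs. The opening values exceed every such count, so placements decrease
  it too.\<close>

fun rank :: "'a::metric_space set \<Rightarrow> 'a position \<Rightarrow> nat" where
  "rank L No_Frog = card (L \<times> L) + 2"
| "rank L (One_Frog x) = card (L \<times> L) + 1"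
| "rank L (Two_Frogs p x y) = card {(u, v) \<in> L \<times> L. dist u v < dist x y}"

lemma rank_legal_move:
  assumes "finite L" "legal_move L q q'" "frogs_in L q"
  shows "rank L q' < rank L q"
proof -
  have decrease: "card {(u, v) \<in> L \<times> L. dist u v < dist a b} <
      card {(u, v) \<in> L \<times> L. dist u v < dist x y}"
    if "a \<in> L" "b \<in> L" "dist a b < dist x y" for a b x y
  proof (rule psubset_card_mono)
    show "finite {(u, v) \<in> L \<times> L. dist u v < dist x y}"
      by (rule finite_subset[of _ "L \<times> L"]) (use assms(1) in auto)
    \<comment> \<open>The pair \<open>(a, b)\<close> itself lies only in the larger set.\<close>
    show "{(u, v) \<in> L \<times> L. dist u v < dist a b} \<subset> {(u, v) \<in> L \<times> L. dist u v < dist x y}"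
      using that by (auto simp: psubset_eq set_eq_iff)
  qed
  have bound: "card {(u, v) \<in> L \<times> L. dist u v < dist x y} < card (L \<times> L) + 1" for x y
    using card_mono[of "L \<times> L" "{(u, v) \<in> L \<times> L. dist u v < dist x y}"] assms(1)
    by (auto simp: less_Suc_eq_le)
  show ?thesis
    using assms(2,3) decrease bound by cases auto
qed

text \<open>\<open>I\<close> collects positions that \<open>P\<close> can restore after every move
  of the opponent. Thus \<open>P\<close> is never stuck, and since play terminates, the opponent is.
  The two cases of \<open>start\<close> cover the opponent or \<open>P\<close> making the opening
  placement.\<close>

lemma win_by_invariant:
  fixes L :: "'a::metric_space set"
  assumes "finite L"
    and turn: "\<And>q. q \<in> I \<Longrightarrow> to_move q = opponent P"
    and return: "\<And>q q'. q \<in> I \<Longrightarrow> legal_move L q q' \<Longrightarrow> \<exists>q''\<in>I. legal_move L q' q''"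
    and start: "No_Frog \<in> I \<or> to_move (No_Frog :: 'a position) = P \<and> (\<exists>q\<in>I. legal_move L No_Frog q)"
  shows "friendly_frogs_win_for L P"
proof -
  define J where "J = {q. to_move q = P \<and> (\<exists>q'\<in>I. legal_move L q q')}"
  \<comment> \<open>Outside \<open>J\<close> any legal move will do; it only makes \<open>s\<close>
    a strategy on all positions.\<close>
  define s where "s q = (if q \<in> J then SOME q'. q' \<in> I \<and> legal_move L q q'
    else SOME q'. legal_move L q q')" for q
  have s_J: "s q \<in> I \<and> legal_move L q (s q)" if "q \<in> J" for q
  proof -
    have "\<exists>q'. q' \<in> I \<and> legal_move L q q'" using that by (auto simp: J_def)
    from someI_ex[OF this] show ?thesis using that by (simp add: s_def)
  qed
  have s: "strategy L P s"
    unfolding strategy_def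
  proof (intro allI impI)
    fix q assume "to_move q = P \<and> \<not> terminal L q"
    then have "\<exists>q'. legal_move L q q'" by (simp add: terminal_def)
    from someI_ex[OF this] show "legal_move L q (s q)"
      using s_J by (cases "q \<in> J") (auto simp: s_def)
  qed
  have "wins_play L P s t" if t: "strategy L (opponent P) t" for t
  proof -
    define q where "q = play P s t"
    have q_0: "q 0 \<in> I \<union> J" using start by (auto simp: q_def J_def)
    have q_Suc: "legal_move L (q k) (q (Suc k)) \<and> q (Suc k) \<in> I \<union> J"
      if "q k \<in> I \<union> J" "\<not> terminal L (q k)" for k
    proof (cases "to_move (q k) = P")
      case True
      then have "q k \<in> J" using that(1) turn[of "q k"] by (metis Un_iff opponent_neq)
      then show ?thesis using s_J True by (simp add: q_def)
    next
      case False
      then have "q k \<in> I" using that(1) by (auto simp: J_def)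
      then have move: "legal_move L (q k) (t (q k))"
        using t that(2) turn[OF \<open>q k \<in> I\<close>] by (simp add: strategy_def)
      then have "t (q k) \<in> J"
        using return[OF \<open>q k \<in> I\<close> move] turn[OF \<open>q k \<in> I\<close>] to_move_legal_move[OF move]
        by (simp add: J_def)
      then show ?thesis using move False by (simp add: q_def)
    qed
    \<comment> \<open>Each move costs at least one unit of rank, so the initial rank bounds the
      number of moves.\<close>
    have inv: "q k \<in> I \<union> J \<and> frogs_in L (q k) \<and> rank L (q k) + k \<le> rank L (q 0)"
      if "\<forall>j<k. \<not> terminal L (q j)" for k
      using that
    proof (induction k)
      case 0
      then show ?case using q_0 by (simp add: q_def)
    next
      case (Suc k)
      then have IH: "q k \<in> I \<union> J" "frogs_in L (q k)" "rank L (q k) + k \<le> rank L (q 0)"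
        by auto
      with q_Suc[of k] Suc.prems have "legal_move L (q k) (q (Suc k))" "q (Suc k) \<in> I \<union> J"
        by auto
      with rank_legal_move[OF assms(1)] frogs_in_legal_move IH show ?case by fastforce
    qed
    have "\<exists>k. terminal L (q k)"
      using inv[of "Suc (rank L (q 0))"] by fastforce
    then obtain k where k: "terminal L (q k)" "\<forall>j<k. \<not> terminal L (q j)"
      using exists_least_iff[of "\<lambda>k. terminal L (q k)"] by blast
    \<comment> \<open>Positions in \<open>J\<close> have a legal move, so play can only stop in
      \<open>I\<close>, on the opponent's turn.\<close>
    then have "q k \<in> I" using inv[OF k(2)] by (auto simp: J_def terminal_def)
    then show ?thesis using k turn[of "q k"] by (auto simp: wins_play_def q_def)
  qed
  then show ?thesis
    using s by (auto simp: friendly_frogs_win_for_def winning_strategy_def)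
qed

section \<open>Moves to and from matched pairs\<close>

text \<open>By stability one frog has a partner closer than the other frog; it stays, and the other
  frog jumps to that partner.\<close>

lemma legal_move_to_matched:
  assumes "stable_matching L m" "x \<in> L" "y \<in> L" "x \<noteq> y" "m x \<noteq> y"
  shows "\<exists>z\<in>L. m z \<noteq> z \<and> legal_move L (Two_Frogs p x y) (Two_Frogs (opponent p) z (m z))"
proof -
  consider "m x \<noteq> x" "dist x (m x) < dist x y" | "m y \<noteq> y" "dist y (m y) < dist x y"
    using assms unfolding stable_matching_def by metis
  then show ?thesis
  proof cases
    case 1
    then show ?thesis
      using assms stable_matchingD[OF assms(1)]
      by (intro bexI[of _ x] conjI legal_move.move_second) auto
  next
    case 2
    have "legal_move L (Two_Frogs p x y) (Two_Frogs (opponent p) (m y) y)"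
      using 2 assms stable_matchingD[OF assms(1)]
      by (intro legal_move.move_first) (auto simp: dist_commute)
    \<comment> \<open>Taking \<open>z\<close> to be \<open>m y\<close> respects the order of the
      frogs, since \<open>m (m y) = y\<close>.\<close>
    then show ?thesis
      using 2 assms stable_matchingD[OF assms(1)] by (intro bexI[of _ "m y"]) auto
  qed
qed

text \<open>Only one frog moves, and as \<open>m\<close> is an involution the frog that stays has no
  partner but the point just vacated.\<close>

lemma legal_move_from_matched:
  assumes "stable_matching L m" "x \<in> L" "legal_move L (Two_Frogs p x (m x)) q"
  obtains u v where "q = Two_Frogs (opponent p) u v" "u \<in> L" "v \<in> L" "u \<noteq> v" "m u \<noteq> v"
  using assms(3)
proof cases
  case (move_first z)
  then have "m z \<noteq> m x" using stable_matchingD(2)[OF assms(1)] assms(2) by metis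
  then show thesis
    using move_first stable_matchingD(1)[OF assms(1,2)] by (intro that[of z "m x"]) auto
next
  case (move_second z)
  then show thesis using assms(2) by (intro that[of x z]) auto
qed

lemma return_to_matched:
  assumes "stable_matching L m" "x \<in> L" "legal_move L (Two_Frogs p x (m x)) q"
  shows "\<exists>z\<in>L. m z \<noteq> z \<and> legal_move L q (Two_Frogs p z (m z))"
proof -
  obtain u v where "q = Two_Frogs (opponent p) u v" "u \<in> L" "v \<in> L" "u \<noteq> v" "m u \<noteq> v"
    using legal_move_from_matched[OF assms] .
  then show ?thesis
    using legal_move_to_matched[OF assms(1), of u v "opponent p"] by simp
qed

section \<open>The winner according to whether an unmatched point exists\<close>

lemma Alice_wins_if_unmatched:
  fixes L :: "'a::metric_space set"
  assumes "finite L" "stable_matching L m" "a \<in> L" "m a = a"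
  shows "friendly_frogs_win_for L Alice"
proof (rule win_by_invariant[OF assms(1)])
  \<comment> \<open>Since \<open>a\<close> has no partner, every answer by Bob creates an unmatched
    pair, from which Alice can reach a matched one.\<close>
  let ?I = "insert (One_Frog a) {Two_Frogs Bob x (m x) | x. x \<in> L \<and> m x \<noteq> x}"
  show "to_move q = opponent Alice" if "q \<in> ?I" for q using that by auto
  show "\<exists>q''\<in>?I. legal_move L q' q''" if "q \<in> ?I" "legal_move L q q'" for q q'
  proof (cases "q = One_Frog a")
    case True
    with that(2) obtain y where "q' = Two_Frogs Alice a y" "y \<in> L" "y \<noteq> a"
      by (auto elim: legal_move.cases)
    then show ?thesis
      using legal_move_to_matched[OF assms(2,3), of y Alice] assms(4) by auto
  next
    case False
    with that return_to_matched[OF assms(2)] show ?thesis by blast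
  qed
  show "No_Frog \<in> ?I \<or>
      to_move (No_Frog :: 'a position) = Alice \<and> (\<exists>q\<in>?I. legal_move L No_Frog q)"
    using assms(3) by (auto intro: legal_move.intros)
qed

lemma Bob_wins_if_all_matched:
  fixes L :: "'a::metric_space set"
  assumes "finite L" "stable_matching L m" "\<And>x. x \<in> L \<Longrightarrow> m x \<noteq> x"
  shows "friendly_frogs_win_for L Bob"
proof (rule win_by_invariant[OF assms(1)])
  \<comment> \<open>Bob reaches a matched pair already with his placement, by choosing the partner
    of Alice's point.\<close>
  let ?I = "insert No_Frog {Two_Frogs Alice x (m x) | x. x \<in> L}"
  show "to_move q = opponent Bob" if "q \<in> ?I" for q using that by auto
  show "\<exists>q''\<in>?I. legal_move L q' q''" if "q \<in> ?I" "legal_move L q q'" for q q'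
  proof (cases "q = No_Frog")
    case True
    with that(2) obtain x where "q' = One_Frog x" "x \<in> L"
      by (auto elim: legal_move.cases)
    then show ?thesis
      using stable_matchingD(1)[OF assms(2)] assms(3) by (auto intro: legal_move.intros)
  next
    case False
    with that return_to_matched[OF assms(2)] show ?thesis by blast
  qed
  show "No_Frog \<in> ?I \<or>
      to_move (No_Frog :: 'a position) = Bob \<and> (\<exists>q\<in>?I. legal_move L No_Frog q)"
    by simp
qed

theorem theorem1:
  fixes L :: "(real ^ 'd) set" and n :: nat
  assumes "finite L"
    and "card L = n"
    and "distinct_distances L"
  shows "(odd n \<longrightarrow> friendly_frogs_win_for L Alice) \<and>
         (even n \<longrightarrow> friendly_frogs_win_for L Bob)"
  using stable_matching_exists[OF assms(1,3)] assms(1,2)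
    Alice_wins_if_unmatched Bob_wins_if_all_matched
  by metis

end
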